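(* Let $D = \,]u_{\min},u_{\max}[\,\times\,]v_{\min},v_{\max}[\, \subset \mathbb{R}^2$ be an open rectangle, let $N\ge 2$, and let $\mathbf{x}: D \to \mathbb{R}^N$ be a smooth parametrized surface. Then the following two conditions are equivalent. (i) The surface has an orthogonal Liouville line element, i.e. there exist real-valued functions $U_1,U_2$ on $]u_{\min},u_{\max}[$ and $V_1,V_2$ on $]v_{\min},v_{\max}[$ such that on all of $D$ the first fundamental form of $\mathbf{x}$ is $$ds^2 = (U_1(u)+V_1(v))\,du^2 + (U_2(u)+V_2(v))\,dv^2 .$$ (ii) The diagonals in each rectangle formed by parameter lines on the surface have the same energy; i.e. for every point $(u_0,v_0)\in D$ and all real $\alpha,\beta\neq 0$ such that the closed rectangle $[u_0-|\alpha|,u_0+|\alpha|]\times[v_0-|\beta|,v_0+|\beta|]$ is contained in $D$, the curves $d_1(t)=(u_0+t\alpha,\;v_0+t\beta)$ and $d_2(t)=(u_0-t\alpha,\;v_0+t\beta)$, $t\in[-1,1]$, satisfy $$E(\mathbf{x}\circ d_1)=E(\mathbf{x}\circ d_2).$$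
   Context: The first fundamental form (line element) of $\mathbf{x}$ is $ds^2 = g_{11}\,du^2+2g_{12}\,du\,dv+g_{22}\,dv^2$ with $g_{11}=\mathbf{x}_u\cdot\mathbf{x}_u$, $g_{12}=\mathbf{x}_u\cdot\mathbf{x}_v$, $g_{22}=\mathbf{x}_v\cdot\mathbf{x}_v$, where $\cdot$ is the Euclidean scalar product and subscripts $u,v$ denote partial derivatives. Thus the condition on the line element means $g_{11}(u,v)=U_1(u)+V_1(v)$, $g_{22}(u,v)=U_2(u)+V_2(v)$ and $g_{12}(u,v)=0$ on $D$. The energy of a smooth curve $p:[a,b]\to\mathbb{R}^N$ is $E(p)=\int_a^b |\dot p(t)|^2\,dt$. For $p(t)=\mathbf{x}(c(t))$ with $c:[a,b]\to D$ this equals $\int_a^b \dot c(t)^{T}\,G(c(t))\,\dot c(t)\,dt$, where $G=(g_{ij})$ is the matrix of the first fundamental form. The parameter lines are the images under $\mathbf{x}$ of the lines $u=\text{const.}$ and $v=\text{const.}$ The diagonals of a rectangle formed by parameter lines on the surface are the images under $\mathbf{x}$ of the two straight diagonals of the corresponding axis-parallel rectangle in $D$, with these straight diagonals parametrized affinely over $[-1,1]$ (they are in general not geodesics of the surface). *)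

theory Defs
  imports "HOL-Analysis.Analysis"
begin

(* C^k and C^infinity maps on an open set S.  For open S, times_diff_on S f k says that f is C^k:
   all directional derivatives of f (with respect to every fixed vector h) are again C^(k-1). *)

primrec times_diff_on ::
  "'a::euclidean_space set \<Rightarrow> ('a \<Rightarrow> 'b::real_normed_vector) \<Rightarrow> nat \<Rightarrow> bool" where
  "times_diff_on S f 0 \<longleftrightarrow> continuous_on S f"
| "times_diff_on S f (Suc k) \<longleftrightarrow>
     (\<forall>p\<in>S. f differentiable (at p)) \<and>
     (\<forall>h. times_diff_on S (\<lambda>p. frechet_derivative f (at p) h) k)"

definition smooth_on ::
  "'a::euclidean_space set \<Rightarrow> ('a \<Rightarrow> 'b::real_normed_vector) \<Rightarrow> bool" where
  "smooth_on S f \<longleftrightarrow> (\<forall>k. times_diff_on S f k)"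

definition partial_u :: "(real \<times> real \<Rightarrow> 'a::real_normed_vector) \<Rightarrow> real \<Rightarrow> real \<Rightarrow> 'a" where
  "partial_u x u v = vector_derivative (\<lambda>s. x (s, v)) (at u)"

definition partial_v :: "(real \<times> real \<Rightarrow> 'a::real_normed_vector) \<Rightarrow> real \<Rightarrow> real \<Rightarrow> 'a" where
  "partial_v x u v = vector_derivative (\<lambda>s. x (u, s)) (at v)"

definition g11 :: "(real \<times> real \<Rightarrow> 'a::real_inner) \<Rightarrow> real \<Rightarrow> real \<Rightarrow> real" where
  "g11 x u v = partial_u x u v \<bullet> partial_u x u v"

definition g12 :: "(real \<times> real \<Rightarrow> 'a::real_inner) \<Rightarrow> real \<Rightarrow> real \<Rightarrow> real" where
  "g12 x u v = partial_u x u v \<bullet> partial_v x u v"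

definition g22 :: "(real \<times> real \<Rightarrow> 'a::real_inner) \<Rightarrow> real \<Rightarrow> real \<Rightarrow> real" where
  "g22 x u v = partial_v x u v \<bullet> partial_v x u v"

(* ds^2 at the point (u, v), as a quadratic form in the tangent vector (du, dv). *)

definition first_fundamental_form ::
  "(real \<times> real \<Rightarrow> 'a::real_inner) \<Rightarrow> real \<Rightarrow> real \<Rightarrow> real \<Rightarrow> real \<Rightarrow> real" where
  "first_fundamental_form x u v du dv =
     g11 x u v * du\<^sup>2 + 2 * g12 x u v * du * dv + g22 x u v * dv\<^sup>2"

(* U1, U2, V1, V2 are total functions, but only their values at coordinates of points of the
   rectangle matter; no regularity is imposed on them. *)

definition orthogonal_liouville_on ::
  "real set \<Rightarrow> real set \<Rightarrow> (real \<times> real \<Rightarrow> 'a::real_inner) \<Rightarrow> bool" where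
  "orthogonal_liouville_on I J x \<longleftrightarrow>
     (\<exists>U1 U2 V1 V2 :: real \<Rightarrow> real. \<forall>u\<in>I. \<forall>v\<in>J. \<forall>du dv.
        first_fundamental_form x u v du dv = (U1 u + V1 v) * du\<^sup>2 + (U2 u + V2 v) * dv\<^sup>2)"

(* One-sided derivatives are used at the end points of the parameter interval. *)

definition energy :: "real \<Rightarrow> real \<Rightarrow> (real \<Rightarrow> 'a::real_normed_vector) \<Rightarrow> real" where
  "energy a b p = integral {a..b} (\<lambda>t. (norm (vector_derivative p (at t within {a..b})))\<^sup>2)"

end

theory Submission
  imports Defs
begin

text \<open>
  Let \<open>F = g11\<close>, \<open>H = g12\<close>, \<open>G = g22\<close>.  Shrinking the rectangle about its centre and differentiating
  the energy identity with respect to the scale turns it into a pointwise identity at the corners: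
  \<open>\<alpha>\<^sup>2 \<Delta>F + 2 \<alpha> \<beta> \<Sigma>H + \<beta>\<^sup>2 \<Delta>G = 0\<close>, where \<open>\<Delta>\<close> is the mixed second difference and \<open>\<Sigma>\<close> the sum over
  the four corners.  With \<open>\<alpha> = \<beta> \<rightarrow> 0\<close> continuity gives \<open>H = 0\<close>.  Then halving the rectangle in the
  \<open>u\<close>-direction, with \<open>\<Delta>\<close> additive, divides the first term by 4 and keeps the other one, so
  \<open>\<Delta>F = \<Delta>G = 0\<close>, which means that \<open>F\<close> and \<open>G\<close> split as sums.  Conversely, for a Liouville line element
  the difference of the two energy densities is an odd function of the curve parameter.
\<close>

section \<open>Integrals over symmetric intervals\<close>

lemma odd_integral_eq_0:
  fixes f :: "real \<Rightarrow> real"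
  assumes "\<And>t. t \<in> {-a..a} \<Longrightarrow> f (- t) = - f t"
  shows "integral {-a..a} f = 0"
proof -
  have "integral {-a..a} f = integral {-a..a} (\<lambda>t. f (- t))"
    using Henstock_Kurzweil_Integration.integral_reflect_real[of a "-a" f] by simp
  also have "\<dots> = integral {-a..a} (\<lambda>t. - f t)"
    by (rule integral_cong) (use assms in auto)
  finally show ?thesis by simp
qed

text \<open>With the antiderivative \<open>I\<close> of \<open>f\<close> based at -1, the
  substitution s * t turns \<open>zero\<close> into I(s) = I(-s) on [0, 1]. The left derivative of
  I(s) - I(-s) at s = 1 is f(1) + f(-1).\<close>

lemma symmetric_integrals_zero_endpoints:
  fixes f :: "real \<Rightarrow> real"
  assumes cont: "continuous_on {-1..1} f"
    and zero: "\<And>s. 0 < s \<Longrightarrow> s \<le> 1 \<Longrightarrow> integral {-1..1} (\<lambda>t. f (s * t)) = 0"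
  shows "f 1 + f (-1) = 0"
proof -
  define I where "I s = integral {-1..s} f" for s
  have I: "(I has_real_derivative f s) (at s within {-1..1})" if "s \<in> {-1..1}" for s
    using integral_has_real_derivative[OF cont that] unfolding I_def .
  \<comment> \<open>Used twice: with arbitrary fixed \<open>s\<close> for the substitution in the
    integral, and with \<open>s\<close> equal to 1 and -1 to differentiate \<open>I\<close> at both
    end points of [-1, 1].\<close>
  have chain: "((\<lambda>t. I (s * t)) has_real_derivative f (s * t) * s) (at t within {-1..1})"
    if "\<bar>s\<bar> \<le> 1" "t \<in> {-1..1}" for s t
  proof -
    have sub: "(\<lambda>t. s * t) ` {-1..1} \<subseteq> {-1..1}"
    proof clarify
      fix r :: real assume "r \<in> {-1..1}"
      then have "\<bar>s * r\<bar> \<le> 1" using that(1) by (auto simp: abs_mult intro!: mult_le_one)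
      then show "s * r \<in> {-1..1}" by auto
    qed
    have "(I has_real_derivative f (s * t)) (at (s * t) within (\<lambda>t. s * t) ` {-1..1})"
      using that(2) sub by (intro DERIV_subset[OF I sub]) blast
    moreover have "((\<lambda>t. s * t) has_real_derivative s) (at t within {-1..1})"
      by (auto intro!: derivative_eq_intros)
    ultimately show ?thesis
      using DERIV_image_chain[of I _ "\<lambda>t. s * t"] by (simp add: o_def)
  qed
  have I_sym: "I s - I (- s) = 0" if "s \<in> {0..1}" for s
  proof (cases "s = 0")
    case False
    have "((\<lambda>t. f (s * t) * s) has_integral (I (s * 1) - I (s * (-1)))) {-1..1}"
      by (rule fundamental_theorem_of_calculus)
        (use chain that in \<open>auto simp: has_real_derivative_iff_has_vector_derivative[symmetric]\<close>)
    then have "integral {-1..1} (\<lambda>t. f (s * t)) * s = I s - I (- s)"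
      by (simp add: integral_unique flip: integral_mult_left)
    then show ?thesis using zero[of s] that False by auto
  qed simp
  \<comment> \<open>The variable here is the \<open>t\<close> of \<open>chain\<close>; the factors
    \<open>1 *\<close> and \<open>-1 *\<close> are written out so that \<open>chain\<close> matches
    at the scales 1 and -1.\<close>
  have "((\<lambda>s. I (1 * s) - I (-1 * s)) has_real_derivative f (1 * 1) * 1 - f (-1 * 1) * (-1))
      (at 1 within {0..1})"
    by (rule DERIV_diff; rule DERIV_subset[OF chain]) auto
  then have "((\<lambda>s. I s - I (- s)) has_real_derivative f 1 + f (-1)) (at 1 within {0..1})"
    by simp
  then have "((\<lambda>s. 0) has_real_derivative f 1 + f (-1)) (at 1 within {0..1})"
    by (rule has_field_derivative_transform_within[OF _ zero_less_one]) (use I_sym in auto)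
  moreover have "((\<lambda>s. 0) has_real_derivative 0) (at (1::real) within {0..1})"
    by simp
  moreover have "at (1::real) within {0..1} \<noteq> bot"
    by (simp add: trivial_limit_within islimpt_Icc)
  ultimately show ?thesis
    using vector_derivative_unique_within
    unfolding has_real_derivative_iff_has_vector_derivative by blast
qed

section \<open>First fundamental form and energy of line segments\<close>

text \<open>Bridge between \<open>smooth_on\<close>, which speaks of Frechet derivatives, and the
  coefficients of the form, which are built from derivatives along coordinate lines.\<close>

lemma
  fixes x :: "real \<times> real \<Rightarrow> 'a::real_normed_vector"
  assumes "x differentiable at (u, v)"
  shows partial_u_eq_frechet_derivative: "partial_u x u v = frechet_derivative x (at (u, v)) (1, 0)"
    and partial_v_eq_frechet_derivative: "partial_v x u v = frechet_derivative x (at (u, v)) (0, 1)"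
proof -
  have D: "(x has_derivative frechet_derivative x (at (u, v))) (at (u, v))"
    using assms frechet_derivative_works by blast
  have "((\<lambda>s. (s, v)) has_vector_derivative (1, 0)) (at u)"
       "((\<lambda>s. (u, s)) has_vector_derivative (0, 1)) (at v)"
    by (auto intro!: derivative_eq_intros simp: has_vector_derivative_def)
  then show "partial_u x u v = frechet_derivative x (at (u, v)) (1, 0)"
       "partial_v x u v = frechet_derivative x (at (u, v)) (0, 1)"
    unfolding partial_u_def partial_v_def
    using vector_derivative_diff_chain_within[of "\<lambda>s. (s, v)" "(1, 0)" u UNIV x]
      vector_derivative_diff_chain_within[of "\<lambda>s. (u, s)" "(0, 1)" v UNIV x] D
    by (auto intro!: vector_derivative_at simp: o_def has_derivative_at_withinI)
qed

lemma norm_frechet_derivative_eq_first_fundamental_form: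
  fixes x :: "real \<times> real \<Rightarrow> 'a::real_inner"
  assumes "x differentiable at (u, v)"
  shows "(norm (frechet_derivative x (at (u, v)) (a, b)))\<^sup>2 = first_fundamental_form x u v a b"
proof -
  have lin: "linear (frechet_derivative x (at (u, v)))"
    using assms linear_frechet_derivative by blast
  have "frechet_derivative x (at (u, v)) (a *\<^sub>R (1, 0) + b *\<^sub>R (0, 1)) =
      a *\<^sub>R partial_u x u v + b *\<^sub>R partial_v x u v"
    unfolding partial_u_eq_frechet_derivative[OF assms] partial_v_eq_frechet_derivative[OF assms]
      linear_add[OF lin] linear_scale[OF lin] ..
  then have "frechet_derivative x (at (u, v)) (a, b) = a *\<^sub>R partial_u x u v + b *\<^sub>R partial_v x u v"
    by simp
  then show ?thesis
    unfolding power2_norm_eq_inner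
    by (simp add: first_fundamental_form_def g11_def g12_def g22_def
        inner_add_left inner_add_right inner_commute power2_eq_square algebra_simps)
qed

text \<open>The signs of \<open>a\<close> and \<open>b\<close> are free, so the two diagonals of a
  rectangle are the instances \<open>a\<close> and \<open>-a\<close>.\<close>

lemma energy_line:
  fixes x :: "real \<times> real \<Rightarrow> 'a::real_inner"
  assumes "\<And>t. t \<in> {-1..1} \<Longrightarrow> x differentiable at (u0 + t * a, v0 + t * b)"
  shows "energy (-1) 1 (x \<circ> (\<lambda>t. (u0 + t * a, v0 + t * b))) =
    integral {-1..1} (\<lambda>t. first_fundamental_form x (u0 + t * a) (v0 + t * b) a b)"
  unfolding energy_def
proof (rule integral_cong)
  fix t :: real assume t: "t \<in> {-1..1}"
  let ?c = "\<lambda>t. (u0 + t * a, v0 + t * b)"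
  have "(?c has_vector_derivative (a, b)) (at t within {-1..1})"
    by (auto intro!: derivative_eq_intros simp: has_vector_derivative_def)
  moreover have "(x has_derivative frechet_derivative x (at (?c t))) (at (?c t) within ?c ` {-1..1})"
    using assms[OF t] frechet_derivative_works has_derivative_at_withinI by blast
  ultimately have "((x \<circ> ?c) has_vector_derivative frechet_derivative x (at (?c t)) (a, b))
      (at t within {-1..1})"
    by (rule vector_derivative_diff_chain_within)
  \<comment> \<open>The interval is nondegenerate, so the derivative within it is unique at its end
    points too.\<close>
  then have "vector_derivative (x \<circ> ?c) (at t within {-1..1}) = frechet_derivative x (at (?c t)) (a, b)"
    using t by (intro vector_derivative_within) (auto simp: trivial_limit_within islimpt_Icc)
  then show "(norm (vector_derivative (x \<circ> ?c) (at t within {-1..1})))\<^sup>2 =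
      first_fundamental_form x (u0 + t * a) (v0 + t * b) a b"
    using norm_frechet_derivative_eq_first_fundamental_form[OF assms[OF t]] by simp
qed

lemma smooth_on_differentiable:
  "smooth_on S f \<Longrightarrow> p \<in> S \<Longrightarrow> f differentiable at p"
  unfolding smooth_on_def by (metis times_diff_on.simps(2))

lemma smooth_on_continuous_frechet_derivative:
  "smooth_on S f \<Longrightarrow> continuous_on S (\<lambda>p. frechet_derivative f (at p) h)"
  unfolding smooth_on_def by (metis times_diff_on.simps)

text \<open>Continuity of the coefficients makes the energy densities integrable and controls the
  limit over shrinking squares.\<close>

lemma smooth_on_continuous_first_fundamental_form:
  fixes x :: "real \<times> real \<Rightarrow> 'a::real_inner"
  assumes "smooth_on S x"
  shows "continuous_on S (\<lambda>p. g11 x (fst p) (snd p))"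
    and "continuous_on S (\<lambda>p. g12 x (fst p) (snd p))"
    and "continuous_on S (\<lambda>p. g22 x (fst p) (snd p))"
proof -
  have "continuous_on S (\<lambda>p. partial_u x (fst p) (snd p))"
    by (rule continuous_on_eq[OF smooth_on_continuous_frechet_derivative[OF assms]])
      (use smooth_on_differentiable[OF assms] in \<open>auto simp: partial_u_eq_frechet_derivative\<close>)
  moreover have "continuous_on S (\<lambda>p. partial_v x (fst p) (snd p))"
    by (rule continuous_on_eq[OF smooth_on_continuous_frechet_derivative[OF assms]])
      (use smooth_on_differentiable[OF assms] in \<open>auto simp: partial_v_eq_frechet_derivative\<close>)
  ultimately show "continuous_on S (\<lambda>p. g11 x (fst p) (snd p))"
    "continuous_on S (\<lambda>p. g12 x (fst p) (snd p))" "continuous_on S (\<lambda>p. g22 x (fst p) (snd p))"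
    unfolding g11_def g12_def g22_def by (auto intro!: continuous_intros)
qed

section \<open>Mixed differences and splitting into sums\<close>

text \<open>Discrete counterpart of the mixed partial derivative of \<open>F\<close>: the
  alternating sum over the corners of [a, b] x [c, d].\<close>

definition mixed_diff :: "(real \<Rightarrow> real \<Rightarrow> real) \<Rightarrow> real \<Rightarrow> real \<Rightarrow> real \<Rightarrow> real \<Rightarrow> real" where
  "mixed_diff F a b c d = F b d - F a d - F b c + F a c"

lemma mixed_diff_split: "mixed_diff F a b c d = mixed_diff F a m c d + mixed_diff F m b c d"
  by (simp add: mixed_diff_def)

text \<open>The rectangle spanned by a base point (p, q) and (u, v) expresses \<open>F u v\<close>
  through values on the two coordinate lines through (p, q).\<close>

lemma separated_of_mixed_diff_zero:
  assumes "\<And>a b c d. a \<in> I \<Longrightarrow> b \<in> I \<Longrightarrow> c \<in> J \<Longrightarrow> d \<in> J \<Longrightarrow> a < b \<Longrightarrow> c < d \<Longrightarrow> mixed_diff F a b c d = 0"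
  shows "\<exists>U V. \<forall>u\<in>I. \<forall>v\<in>J. F u v = U u + V v"
proof (cases "I = {} \<or> J = {}")
  case False
  then obtain p q where pq: "p \<in> I" "q \<in> J" by blast
  have "F u v = F u q + (F p v - F p q)" if "u \<in> I" "v \<in> J" for u v
    \<comment> \<open>The hypothesis covers ordered corners only, hence one instance for each
      position of (u, v) relative to (p, q); if u = p or v = q the equation is trivial.\<close>
    using assms[of u p v q] assms[of u p q v] assms[of p u v q] assms[of p u q v] pq that
    by (cases u p rule: linorder_cases; cases v q rule: linorder_cases) (auto simp: mixed_diff_def)
  then show ?thesis
    by (intro exI[of _ "\<lambda>u. F u q"] exI[of _ "\<lambda>v. F p v - F p q"]) auto
qed auto

text \<open>The weights are quadratic in the side lengths while \<open>mixed_diff\<close> is only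
  additive, so bisecting a rectangle separates the two terms.\<close>

lemma mixed_diff_zero_of_weighted:
  fixes F G :: "real \<Rightarrow> real \<Rightarrow> real"
  assumes w: "\<And>a b c d. \<lbrakk>p < a; a < b; b < q; r < c; c < d; d < s\<rbrakk> \<Longrightarrow>
      (b - a)\<^sup>2 * mixed_diff F a b c d + (d - c)\<^sup>2 * mixed_diff G a b c d = 0"
    and ab: "p < a" "a < b" "b < q" "r < c" "c < d" "d < s"
  shows "mixed_diff F a b c d = 0" and "mixed_diff G a b c d = 0"
proof -
  define m where "m = (a + b) / 2"
  have m: "m - a = (b - a) / 2" "b - m = (b - a) / 2" "a < m" "m < b"
    using ab by (auto simp: m_def field_simps)
  have "((b - a) / 2)\<^sup>2 * mixed_diff F a m c d + (d - c)\<^sup>2 * mixed_diff G a m c d = 0"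
    "((b - a) / 2)\<^sup>2 * mixed_diff F m b c d + (d - c)\<^sup>2 * mixed_diff G m b c d = 0"
    using w[of a m c d] w[of m b c d] ab m by auto
  then have "((b - a) / 2)\<^sup>2 * mixed_diff F a b c d + (d - c)\<^sup>2 * mixed_diff G a b c d = 0"
    unfolding mixed_diff_split[of F a b c d m] mixed_diff_split[of G a b c d m]
    by (simp add: algebra_simps)
  then have "(b - a)\<^sup>2 * mixed_diff F a b c d / 4 + (d - c)\<^sup>2 * mixed_diff G a b c d = 0"
    by (simp add: power_divide)
  \<comment> \<open>Subtracting from the identity for the whole rectangle leaves 3/4 of the first
    term.\<close>
  then have "(b - a)\<^sup>2 * mixed_diff F a b c d = 0"
    using w[OF ab] by linarith
  then show "mixed_diff F a b c d = 0" using ab by simp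
  then show "mixed_diff G a b c d = 0" using w[OF ab] ab by simp
qed

section \<open>From energies to the corners of a rectangle\<close>

text \<open>Equal energies at all scales s give vanishing symmetric integrals of the difference of
  the two densities, and the end points of the diagonals are the four corners.\<close>

lemma corner_identity:
  fixes x :: "real \<times> real \<Rightarrow> 'a::real_inner"
  assumes sm: "smooth_on S x"
    and sub: "{u0 - \<alpha>..u0 + \<alpha>} \<times> {v0 - \<beta>..v0 + \<beta>} \<subseteq> S" and pos: "\<alpha> > 0" "\<beta> > 0"
    and energy: "\<And>s. 0 < s \<Longrightarrow> s \<le> 1 \<Longrightarrow>
      energy (-1) 1 (x \<circ> (\<lambda>t. (u0 + t * (s * \<alpha>), v0 + t * (s * \<beta>)))) =
      energy (-1) 1 (x \<circ> (\<lambda>t. (u0 - t * (s * \<alpha>), v0 + t * (s * \<beta>))))"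
  shows "\<alpha>\<^sup>2 * mixed_diff (g11 x) (u0 - \<alpha>) (u0 + \<alpha>) (v0 - \<beta>) (v0 + \<beta>) +
    \<beta>\<^sup>2 * mixed_diff (g22 x) (u0 - \<alpha>) (u0 + \<alpha>) (v0 - \<beta>) (v0 + \<beta>) +
    2 * \<alpha> * \<beta> * (g12 x (u0 + \<alpha>) (v0 + \<beta>) + g12 x (u0 - \<alpha>) (v0 + \<beta>) +
      g12 x (u0 + \<alpha>) (v0 - \<beta>) + g12 x (u0 - \<alpha>) (v0 - \<beta>)) = 0"
proof -
  \<comment> \<open>Energy density of the full-size diagonal with velocity (a, \<beta>); the two
    diagonals are a = \<alpha> and a = -\<alpha>.\<close>
  define q where "q a t = first_fundamental_form x (u0 + t * a) (v0 + t * \<beta>) a \<beta>" for a t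
  have mem: "(u0 + t * a, v0 + t * \<beta>) \<in> S" if "\<bar>a\<bar> = \<alpha>" "t \<in> {-1..1}" for a t
  proof -
    have "\<bar>t * a\<bar> \<le> \<alpha>" "\<bar>t * \<beta>\<bar> \<le> \<beta>"
      using that pos by (auto simp: abs_mult intro!: mult_left_le_one_le)
    then show ?thesis using sub by (auto simp: abs_le_iff subset_iff)
  qed
  have cont: "continuous_on {-1..1} (q a)" if "\<bar>a\<bar> = \<alpha>" for a
  proof -
    have *: "continuous_on {-1..1} (\<lambda>t. g x (u0 + t * a) (v0 + t * \<beta>))"
      if "continuous_on S (\<lambda>p. g x (fst p) (snd p))" for g :: "(real \<times> real \<Rightarrow> 'a) \<Rightarrow> real \<Rightarrow> real \<Rightarrow> real"
      using continuous_on_compose2[OF that, of "{-1..1}" "\<lambda>t. (u0 + t * a, v0 + t * \<beta>)"] mem[OF \<open>\<bar>a\<bar> = \<alpha>\<close>]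
      by (force intro!: continuous_intros)
    show ?thesis
      unfolding q_def first_fundamental_form_def
      by (intro continuous_intros * smooth_on_continuous_first_fundamental_form sm)
  qed
  \<comment> \<open>The scaled diagonal at time t sits at time s * t of the full one, and the
    quadratic form gives the factor \<open>s\<^sup>2\<close>.\<close>
  have en: "energy (-1) 1 (x \<circ> (\<lambda>t. (u0 + t * (s * a), v0 + t * (s * \<beta>)))) =
      s\<^sup>2 * integral {-1..1} (\<lambda>t. q a (s * t))"
    and int: "(\<lambda>t. q a (s * t)) integrable_on {-1..1}"
    if "\<bar>a\<bar> = \<alpha>" "0 < s" "s \<le> 1" for a s
  proof -
    have st: "s * t \<in> {-1..1}" if "t \<in> {-1..1}" for t
    proof -
      have "\<bar>s * t\<bar> \<le> 1" using that \<open>0 < s\<close> \<open>s \<le> 1\<close> by (auto simp: abs_mult intro!: mult_le_one)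
      then show ?thesis by auto
    qed
    have "x differentiable at (u0 + t * (s * a), v0 + t * (s * \<beta>))" if "t \<in> {-1..1}" for t
      using smooth_on_differentiable[OF sm mem[OF \<open>\<bar>a\<bar> = \<alpha>\<close> st[OF that]]] by (simp add: mult_ac)
    then have "energy (-1) 1 (x \<circ> (\<lambda>t. (u0 + t * (s * a), v0 + t * (s * \<beta>)))) =
        integral {-1..1} (\<lambda>t. s\<^sup>2 * q a (s * t))"
      by (subst energy_line)
        (auto simp: q_def first_fundamental_form_def algebra_simps power2_eq_square)
    then show "energy (-1) 1 (x \<circ> (\<lambda>t. (u0 + t * (s * a), v0 + t * (s * \<beta>)))) =
        s\<^sup>2 * integral {-1..1} (\<lambda>t. q a (s * t))" by simp
    show "(\<lambda>t. q a (s * t)) integrable_on {-1..1}"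
      by (intro integrable_continuous_real continuous_on_compose2[OF cont[OF \<open>\<bar>a\<bar> = \<alpha>\<close>]] continuous_intros)
        (use st in auto)
  qed
  have "(q \<alpha> 1 - q (-\<alpha>) 1) + (q \<alpha> (-1) - q (-\<alpha>) (-1)) = 0"
  proof (rule symmetric_integrals_zero_endpoints[of "\<lambda>t. q \<alpha> t - q (-\<alpha>) t"])
    show "continuous_on {-1..1} (\<lambda>t. q \<alpha> t - q (-\<alpha>) t)"
      using pos by (intro continuous_intros cont) auto
    fix s :: real assume s: "0 < s" "s \<le> 1"
    have "s\<^sup>2 * integral {-1..1} (\<lambda>t. q \<alpha> (s * t)) = s\<^sup>2 * integral {-1..1} (\<lambda>t. q (-\<alpha>) (s * t))"
      using en[of \<alpha> s] en[of "-\<alpha>" s] energy[of s] s pos by simp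
    then show "integral {-1..1} (\<lambda>t. q \<alpha> (s * t) - q (-\<alpha>) (s * t)) = 0"
      using s pos by (subst Henstock_Kurzweil_Integration.integral_diff) (auto intro!: int)
  qed
  \<comment> \<open>Only the cross term changes sign with \<open>a\<close>, so its four corner
    values add up while those of \<open>g11\<close> and \<open>g22\<close> alternate.\<close>
  then show ?thesis
    by (simp add: q_def first_fundamental_form_def mixed_diff_def algebra_simps)
qed

text \<open>After division by \<open>e\<^sup>2\<close> the mixed differences tend to 0 and the sum
  over the corners tends to 4 H(u, v), leaving 8 H(u, v) = 0.\<close>

lemma mixed_term_zero_of_corner_identity:
  fixes F G H :: "real \<Rightarrow> real \<Rightarrow> real"
  assumes S: "open S" "(u, v) \<in> S"
    and cont: "continuous_on S (\<lambda>p. F (fst p) (snd p))" "continuous_on S (\<lambda>p. G (fst p) (snd p))"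
      "continuous_on S (\<lambda>p. H (fst p) (snd p))"
    and corner: "\<forall>\<^sub>F e in at_right 0. e\<^sup>2 * mixed_diff F (u - e) (u + e) (v - e) (v + e) +
      e\<^sup>2 * mixed_diff G (u - e) (u + e) (v - e) (v + e) +
      2 * e * e * (H (u + e) (v + e) + H (u - e) (v + e) + H (u + e) (v - e) + H (u - e) (v - e)) = 0"
  shows "H u v = 0"
proof -
  \<comment> \<open>The signs \<open>i\<close> and \<open>j\<close> select the corner, so one limit
    serves all four.\<close>
  have lim: "((\<lambda>e. K (u + i * e) (v + j * e)) \<longlongrightarrow> K u v) (at_right 0)"
    if "continuous_on S (\<lambda>p. K (fst p) (snd p))" for K :: "real \<Rightarrow> real \<Rightarrow> real" and i j
  proof -
    have "isCont (\<lambda>p. K (fst p) (snd p)) (u, v)"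
      using that S by (simp add: continuous_on_eq_continuous_at)
    moreover have "((\<lambda>e. (u + i * e, v + j * e)) \<longlongrightarrow> (u, v)) (at_right 0)"
      by (auto intro!: tendsto_eq_intros)
    ultimately show ?thesis using isCont_tendsto_compose by fastforce
  qed
  let ?f = "\<lambda>e. mixed_diff F (u - e) (u + e) (v - e) (v + e) + mixed_diff G (u - e) (u + e) (v - e) (v + e) +
      2 * (H (u + e) (v + e) + H (u - e) (v + e) + H (u + e) (v - e) + H (u - e) (v - e))"
  have "(?f \<longlongrightarrow> (F u v - F u v - F u v + F u v) + (G u v - G u v - G u v + G u v) +
      2 * (H u v + H u v + H u v + H u v)) (at_right 0)"
    unfolding mixed_diff_def
    using lim[of _ 1 1] lim[of _ 1 "-1"] lim[of _ "-1" 1] lim[of _ "-1" "-1"] cont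
    by (intro tendsto_intros) auto
  then have "(?f \<longlongrightarrow> 8 * H u v) (at_right 0)" by simp
  moreover have "\<forall>\<^sub>F e in at_right 0. ?f e = 0"
    using corner eventually_at_right_less[of 0]
  proof eventually_elim
    case (elim e)
    from elim(1) have "e\<^sup>2 * ?f e = 0" by (simp add: algebra_simps power2_eq_square)
    then show ?case using elim(2) by simp
  qed
  ultimately have "((\<lambda>e::real. 0) \<longlongrightarrow> 8 * H u v) (at_right 0)"
    by (rule Lim_transform_eventually)
  then have "8 * H u v = 0"
    by (rule tendsto_unique[OF trivial_limit_at_right_real _ tendsto_const])
  then show ?thesis by simp
qed

section \<open>The equivalence\<close>

theorem theorem2p6:
  fixes umin umax vmin vmax :: real
    and x :: "real \<times> real \<Rightarrow> real ^ 'n"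
    and D :: "(real \<times> real) set"
  assumes "CARD('n) \<ge> 2"
    and "umin < umax" and "vmin < vmax"
    and "D = {umin<..<umax} \<times> {vmin<..<vmax}"
    and "smooth_on D x"
  shows "orthogonal_liouville_on {umin<..<umax} {vmin<..<vmax} x \<longleftrightarrow>
    (\<forall>u0 v0 \<alpha> \<beta>. (u0, v0) \<in> D \<and> \<alpha> \<noteq> 0 \<and> \<beta> \<noteq> 0 \<and>
        {u0 - \<bar>\<alpha>\<bar>..u0 + \<bar>\<alpha>\<bar>} \<times> {v0 - \<bar>\<beta>\<bar>..v0 + \<bar>\<beta>\<bar>} \<subseteq> D \<longrightarrow>
        energy (-1) 1 (x \<circ> (\<lambda>t. (u0 + t * \<alpha>, v0 + t * \<beta>))) =
        energy (-1) 1 (x \<circ> (\<lambda>t. (u0 - t * \<alpha>, v0 + t * \<beta>))))"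
    (is "?L \<longleftrightarrow> ?R")
proof
  assume ?L
  then obtain U1 U2 V1 V2 where form: "\<And>u v du dv. (u, v) \<in> D \<Longrightarrow>
      first_fundamental_form x u v du dv = (U1 u + V1 v) * du\<^sup>2 + (U2 u + V2 v) * dv\<^sup>2"
    unfolding orthogonal_liouville_on_def assms(4) by blast
  show ?R
  proof (intro allI impI, elim conjE)
    fix u0 v0 \<alpha> \<beta> :: real
    assume sub: "{u0 - \<bar>\<alpha>\<bar>..u0 + \<bar>\<alpha>\<bar>} \<times> {v0 - \<bar>\<beta>\<bar>..v0 + \<bar>\<beta>\<bar>} \<subseteq> D"
    have mem: "(u0 + t * a, v0 + t * \<beta>) \<in> D" if "\<bar>a\<bar> = \<bar>\<alpha>\<bar>" "t \<in> {-1..1}" for a t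
    proof -
      have "\<bar>t * a\<bar> \<le> \<bar>\<alpha>\<bar>" "\<bar>t * \<beta>\<bar> \<le> \<bar>\<beta>\<bar>"
        using that by (auto simp: abs_mult intro!: mult_left_le_one_le)
      then show ?thesis using sub by (auto simp: abs_le_iff subset_iff)
    qed
    define q where "q a t = first_fundamental_form x (u0 + t * a) (v0 + t * \<beta>) a \<beta>" for a t
    have en: "energy (-1) 1 (x \<circ> (\<lambda>t. (u0 + t * a, v0 + t * \<beta>))) = integral {-1..1} (q a)"
      and int: "q a integrable_on {-1..1}"
      if "\<bar>a\<bar> = \<bar>\<alpha>\<bar>" for a
    proof -
      show "energy (-1) 1 (x \<circ> (\<lambda>t. (u0 + t * a, v0 + t * \<beta>))) = integral {-1..1} (q a)"
        unfolding q_def by (rule energy_line) (use mem that smooth_on_differentiable assms(5) in blast)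
      \<comment> \<open>Integrability comes from the continuous coefficients of the form, since
        \<open>U1\<close>, \<open>U2\<close>, \<open>V1\<close>, \<open>V2\<close> carry no
        regularity.\<close>
      have *: "continuous_on {-1..1} (\<lambda>t. g x (u0 + t * a) (v0 + t * \<beta>))"
        if "continuous_on D (\<lambda>p. g x (fst p) (snd p))" for g :: "(real \<times> real \<Rightarrow> real^'n) \<Rightarrow> real \<Rightarrow> real \<Rightarrow> real"
        using continuous_on_compose2[OF that, of "{-1..1}" "\<lambda>t. (u0 + t * a, v0 + t * \<beta>)"] mem[OF \<open>\<bar>a\<bar> = \<bar>\<alpha>\<bar>\<close>]
        by (force intro!: continuous_intros)
      show "q a integrable_on {-1..1}"
        unfolding q_def first_fundamental_form_def
        by (intro integrable_continuous_real continuous_intros *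
            smooth_on_continuous_first_fundamental_form assms(5))
    qed
    \<comment> \<open>Both densities share the V terms, so the difference contains only U1(u0 +
      t\<alpha>) - U1(u0 - t\<alpha>) and the same for \<open>U2\<close>, weighted by the squares of
      \<alpha> and \<beta>: an odd function of t.\<close>
    have "integral {-1..1} (\<lambda>t. q \<alpha> t - q (-\<alpha>) t) = 0"
    proof (rule odd_integral_eq_0)
      fix t :: real assume "t \<in> {-1..1}"
      then show "q \<alpha> (- t) - q (- \<alpha>) (- t) = - (q \<alpha> t - q (- \<alpha>) t)"
        unfolding q_def using mem[of \<alpha> t] mem[of "-\<alpha>" t] mem[of \<alpha> "-t"] mem[of "-\<alpha>" "-t"]
        by (simp add: form algebra_simps)
    qed
    then show "energy (-1) 1 (x \<circ> (\<lambda>t. (u0 + t * \<alpha>, v0 + t * \<beta>))) =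
        energy (-1) 1 (x \<circ> (\<lambda>t. (u0 - t * \<alpha>, v0 + t * \<beta>)))"
      using en[of \<alpha>] en[of "-\<alpha>"] int[of \<alpha>] int[of "-\<alpha>"]
      by (simp add: Henstock_Kurzweil_Integration.integral_diff)
  qed
next
  assume R: ?R
  have cont: "continuous_on D (\<lambda>p. g11 x (fst p) (snd p))" "continuous_on D (\<lambda>p. g22 x (fst p) (snd p))"
      "continuous_on D (\<lambda>p. g12 x (fst p) (snd p))"
    using smooth_on_continuous_first_fundamental_form[OF assms(5)] by auto
  have corner: "\<alpha>\<^sup>2 * mixed_diff (g11 x) (u0 - \<alpha>) (u0 + \<alpha>) (v0 - \<beta>) (v0 + \<beta>) +
    \<beta>\<^sup>2 * mixed_diff (g22 x) (u0 - \<alpha>) (u0 + \<alpha>) (v0 - \<beta>) (v0 + \<beta>) +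
    2 * \<alpha> * \<beta> * (g12 x (u0 + \<alpha>) (v0 + \<beta>) + g12 x (u0 - \<alpha>) (v0 + \<beta>) +
      g12 x (u0 + \<alpha>) (v0 - \<beta>) + g12 x (u0 - \<alpha>) (v0 - \<beta>)) = 0"
    if "\<alpha> > 0" "\<beta> > 0" "umin < u0 - \<alpha>" "u0 + \<alpha> < umax" "vmin < v0 - \<beta>" "v0 + \<beta> < vmax" for u0 v0 \<alpha> \<beta>
  proof (rule corner_identity[OF assms(5)])
    show "{u0 - \<alpha>..u0 + \<alpha>} \<times> {v0 - \<beta>..v0 + \<beta>} \<subseteq> D" "\<alpha> > 0" "\<beta> > 0"
      using that unfolding assms(4) by auto
    fix s :: real assume s: "0 < s" "s \<le> 1"
    define p where "p = s * \<alpha>"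
    define q where "q = s * \<beta>"
    from s have "p \<le> \<alpha>" "q \<le> \<beta>" "0 < p" "0 < q" using that by (auto simp: p_def q_def)
    moreover from this that have "{u0 - \<bar>p\<bar>..u0 + \<bar>p\<bar>} \<times> {v0 - \<bar>q\<bar>..v0 + \<bar>q\<bar>} \<subseteq> D" "(u0, v0) \<in> D"
      unfolding assms(4) by auto
    ultimately show "energy (-1) 1 (x \<circ> (\<lambda>t. (u0 + t * (s * \<alpha>), v0 + t * (s * \<beta>)))) =
      energy (-1) 1 (x \<circ> (\<lambda>t. (u0 - t * (s * \<alpha>), v0 + t * (s * \<beta>))))"
      using R[rule_format, of u0 v0 p q] s unfolding p_def q_def by auto
  qed
  have H: "g12 x u v = 0" if "(u, v) \<in> D" for u v
  proof (rule mixed_term_zero_of_corner_identity[of D u v "g11 x" "g22 x" "g12 x", OF _ that cont])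
    show "open D" unfolding assms(4) by (intro open_Times) auto
    \<comment> \<open>Distance from (u, v) to the nearest side of \<open>D\<close>, so squares of
      half side e < m fit inside.\<close>
    define m where "m = min (min (u - umin) (umax - u)) (min (v - vmin) (vmax - v))"
    have "m > 0" using that unfolding assms(4) m_def by auto
    then have "\<forall>\<^sub>F e in at_right 0. e \<in> {0<..<m}"
      by (rule eventually_at_right_real)
    then show "\<forall>\<^sub>F e in at_right 0. e\<^sup>2 * mixed_diff (g11 x) (u - e) (u + e) (v - e) (v + e) +
      e\<^sup>2 * mixed_diff (g22 x) (u - e) (u + e) (v - e) (v + e) +
      2 * e * e * (g12 x (u + e) (v + e) + g12 x (u - e) (v + e) + g12 x (u + e) (v - e) + g12 x (u - e) (v - e)) = 0"
      by eventually_elim (rule corner; auto simp: m_def)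
  qed
  have weighted: "(b - a)\<^sup>2 * mixed_diff (g11 x) a b c d + (d - c)\<^sup>2 * mixed_diff (g22 x) a b c d = 0"
    if "umin < a" "a < b" "b < umax" "vmin < c" "c < d" "d < vmax" for a b c d
  proof -
    \<comment> \<open>Passes from centre and half sides to corners; the common factor 1/4 of both
      weights cancels.\<close>
    have eq: "(a + b) / 2 - (b - a) / 2 = a" "(a + b) / 2 + (b - a) / 2 = b"
      "(c + d) / 2 - (d - c) / 2 = c" "(c + d) / 2 + (d - c) / 2 = d"
      by (simp_all add: field_simps)
    have "g12 x a c = 0" "g12 x a d = 0" "g12 x b c = 0" "g12 x b d = 0"
      using that unfolding assms(4) by (auto intro!: H simp: assms(4))
    then have "((b - a) / 2)\<^sup>2 * mixed_diff (g11 x) a b c d + ((d - c) / 2)\<^sup>2 * mixed_diff (g22 x) a b c d = 0"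
      using corner[of "(b - a) / 2" "(d - c) / 2" "(a + b) / 2" "(c + d) / 2", unfolded eq] that by simp
    then show ?thesis by (simp add: power_divide)
  qed
  have "mixed_diff (g11 x) a b c d = 0" "mixed_diff (g22 x) a b c d = 0"
    if "a \<in> {umin<..<umax}" "b \<in> {umin<..<umax}" "c \<in> {vmin<..<vmax}" "d \<in> {vmin<..<vmax}" "a < b" "c < d"
    for a b c d
    using mixed_diff_zero_of_weighted[OF weighted] that by auto
  then obtain U1 V1 U2 V2 where
    "\<forall>u\<in>{umin<..<umax}. \<forall>v\<in>{vmin<..<vmax}. g11 x u v = U1 u + V1 v"
    "\<forall>u\<in>{umin<..<umax}. \<forall>v\<in>{vmin<..<vmax}. g22 x u v = U2 u + V2 v"
    using separated_of_mixed_diff_zero[of "{umin<..<umax}" "{vmin<..<vmax}" "g11 x"]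
      separated_of_mixed_diff_zero[of "{umin<..<umax}" "{vmin<..<vmax}" "g22 x"] by metis
  with H show ?L
    unfolding orthogonal_liouville_on_def first_fundamental_form_def assms(4)
    by (intro exI[of _ U1] exI[of _ U2] exI[of _ V1] exI[of _ V2]) auto
qed

end
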